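(* Fix $p\in(0,1)$. Let $(\theta_k)$ be the Markov chain on the positive integers which from state $d$ moves to $1$ with probability $1-(1-p)^d$, to $d+1$ with probability $p(1-p)^d$, and stays at $d$ with probability $(1-p)^{d+1}$; and let $(\phi_k)$ be the Markov chain on the positive integers which from state $d$ moves to $1$ with probability $1-(1-p)^d$ and to $d+1$ with probability $(1-p)^d$. Let $f(p)$ and $h(p)$ be the stationary probabilities of a move to state $1$ (i.e. the expected height increments $\mathbb{E}_\pi[1-(1-p)^{\theta}]$ and $\mathbb{E}_\pi[1-(1-p)^{\phi}]$ under the respective stationary distributions). Then $$f(p)=1-\frac{\displaystyle\sum_{j=1}^{\infty}\Bigl(\prod_{i=1}^{j-1}\frac{p(1-p)^i}{1-(1-p)^{i+2}}\Bigr)(1-p)^j}{\displaystyle\sum_{j=1}^{\infty}\prod_{i=1}^{j-1}\frac{p(1-p)^i}{1-(1-p)^{i+2}}},\qquad h(p)=\frac{1}{\displaystyle\sum_{j=1}^{\infty}(1-p)^{j(j-1)/2}}.$$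
   Context: These chains model an underestimate and an overestimate of the growth of the height of the random graph order $P(n,p)$ built by adding vertices one at a time (each new vertex joined to each earlier vertex independently with probability $p$): the state is the (estimated) number of top endpoints of longest chains, and a move to state $1$ corresponds to the height increasing by one. Empty products equal $1$. *)

theory Defs
  imports "HOL-Probability.Probability"
begin

(* A Markov chain on a countable state space is given by its transition kernel;
   the positive integers are the states {1..} of type nat.

   pmf_of_list adds up the weights of repeated entries, so in state d = 1 the two
   moves "to 1" and "stay at d" of theta_step are merged into one transition, of
   probability p + (1 - p)^2, as they should be. *)

definition theta_step :: "real \<Rightarrow> nat \<Rightarrow> nat pmf" where
  "theta_step p d = pmf_of_list
     [(1, 1 - (1 - p) ^ d), (d + 1, p * (1 - p) ^ d), (d, (1 - p) ^ (d + 1))]"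

definition phi_step :: "real \<Rightarrow> nat \<Rightarrow> nat pmf" where
  "phi_step p d = pmf_of_list [(1, 1 - (1 - p) ^ d), (d + 1, (1 - p) ^ d)]"

lemma theta_step_wf:
  fixes p :: real
  assumes "p \<in> {0<..<1}"
  shows "pmf_of_list_wf
     [(1, 1 - (1 - p) ^ d), (d + 1, p * (1 - p) ^ d), (d, (1 - p) ^ (d + 1))]"
  using assms by (auto simp: pmf_of_list_wf_def power_le_one algebra_simps)

lemma phi_step_wf:
  fixes p :: real
  assumes "p \<in> {0<..<1}"
  shows "pmf_of_list_wf [(1, 1 - (1 - p) ^ d), (d + 1, (1 - p) ^ d)]"
  using assms by (auto simp: pmf_of_list_wf_def power_le_one)

lemma pmf_theta_step:
  fixes p :: real
  assumes "p \<in> {0<..<1}"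
  shows "pmf (theta_step p d) e =
     (if e = 1 then 1 - (1 - p) ^ d else 0) +
     (if e = d + 1 then p * (1 - p) ^ d else 0) +
     (if e = d then (1 - p) ^ (d + 1) else 0)"
  unfolding theta_step_def pmf_pmf_of_list[OF theta_step_wf[OF assms]] by simp

lemma pmf_phi_step:
  fixes p :: real
  assumes "p \<in> {0<..<1}"
  shows "pmf (phi_step p d) e =
     (if e = 1 then 1 - (1 - p) ^ d else 0) +
     (if e = d + 1 then (1 - p) ^ d else 0)"
  unfolding phi_step_def pmf_pmf_of_list[OF phi_step_wf[OF assms]] by simp

definition stationary_distribution :: "'a set \<Rightarrow> ('a \<Rightarrow> 'a pmf) \<Rightarrow> 'a pmf \<Rightarrow> bool" where
  "stationary_distribution S K \<pi> \<longleftrightarrow> set_pmf \<pi> \<subseteq> S \<and> bind_pmf \<pi> K = \<pi>"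

(* The height grows in state d with probability 1 - (1 - p)^d; for theta in state 1
   this does not count the event of staying at 1. The definite descriptions are
   meaningful only where the stationary distribution exists and is unique. *)

definition f_rate :: "real \<Rightarrow> real" where
  "f_rate p = measure_pmf.expectation
     (THE \<pi>. stationary_distribution {1..} (theta_step p) \<pi>) (\<lambda>d. 1 - (1 - p) ^ d)"

definition h_rate :: "real \<Rightarrow> real" where
  "h_rate p = measure_pmf.expectation
     (THE \<pi>. stationary_distribution {1..} (phi_step p) \<pi>) (\<lambda>d. 1 - (1 - p) ^ d)"

end

theory Submission imports Defs begin

text \<open>
  In both chains every move goes one step up, nowhere, or to state 1, so the balance equation at a
  state \<open>e \<ge> 2\<close> only involves \<open>e - 1\<close> and \<open>e\<close> and determines the ratio of their stationary
  weights. The balance equation at 1 then holds automatically because total mass is preserved.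
  The ratios are at most \<open>1 - p\<close>, so the weights are dominated by a geometric series and can be
  normalised. For \<open>\<phi>\<close>, the balance equation at state 1 says that the probability of a move to 1 is
  the stationary mass of 1 itself, i.e. the inverse of the normalising constant.
\<close>

text \<open>Total mass 1 determines the value at \<open>a\<close> from the others. This yields the
  balance equation at state 1 from all the rest.\<close>

lemma pmf_eqI_except_one:
  assumes "\<And>x. x \<noteq> a \<Longrightarrow> pmf P x = pmf Q x"
  shows "P = Q"
proof (rule pmf_eqI)
  fix x
  have compl: "pmf R a = 1 - infsetsum (pmf R) (- {a})" for R :: "'a pmf"
    using measure_pmf.prob_compl[of "- {a}" R]
    by (simp add: measure_pmf_conv_infsetsum[symmetric] measure_pmf_single Compl_eq_Diff_UNIV[symmetric])
  have "infsetsum (pmf P) (- {a}) = infsetsum (pmf Q) (- {a})"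
    using assms by (intro infsetsum_cong) auto
  then show "pmf P x = pmf Q x"
    using assms[of x] compl by (cases "x = a") simp_all
qed

lemma pmf_eqI_proportional:
  assumes "\<And>x. pmf P x = c * pmf Q x"
  shows "P = Q"
proof -
  \<comment> \<open>The sign of \<open>c\<close> is read off at a point of the support of
    \<open>Q\<close>; it is used to split \<open>ennreal (c * pmf Q x)\<close>.\<close>
  obtain x where "x \<in> set_pmf Q"
    using set_pmf_not_empty[of Q] by blast
  then have "0 < pmf Q x"
    by (rule pmf_positive)
  moreover have "0 \<le> c * pmf Q x"
    using assms[of x] pmf_nonneg[of P x] by simp
  ultimately have "0 \<le> c"
    by (simp add: zero_le_mult_iff)
  have "1 = (\<integral>\<^sup>+x. ennreal (c * pmf Q x) \<partial>count_space UNIV)"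
    using nn_integral_pmf_eq_1[of P] by (simp add: assms)
  also have "\<dots> = ennreal c * (\<integral>\<^sup>+x. ennreal (pmf Q x) \<partial>count_space UNIV)"
    using \<open>0 \<le> c\<close> by (simp add: ennreal_mult nn_integral_cmult)
  finally have "c = 1"
    by (simp add: nn_integral_pmf_eq_1)
  then show ?thesis
    using assms by (intro pmf_eqI) simp
qed

lemma ratio_prod_le:
  fixes r :: "nat \<Rightarrow> real"
  assumes "\<And>i. i \<ge> 1 \<Longrightarrow> 0 \<le> r i" "\<And>i. i \<ge> 1 \<Longrightarrow> r i \<le> q"
  shows "(\<Prod>i\<in>{1..<j}. r i) \<le> q ^ (j - 1)"
  using prod_mono[of "{1..<j}" r "\<lambda>_. q"] assms by simp

lemma summable_on_ratio_prod:
  fixes r :: "nat \<Rightarrow> real"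
  assumes "\<And>i. i \<ge> 1 \<Longrightarrow> 0 \<le> r i" "\<And>i. i \<ge> 1 \<Longrightarrow> r i \<le> q" "0 < q" "q < 1"
  shows "(\<lambda>j. \<Prod>i\<in>{1..<j}. r i) summable_on {1..}"
proof -
  \<comment> \<open>On \<open>{1..}\<close>, \<open>q ^ j / q\<close> is \<open>q ^ (j - 1)\<close>,
    the bound on a product of \<open>j - 1\<close> ratios.\<close>
  have "(\<lambda>j. q ^ j / q) summable_on UNIV"
    using assms by (subst summable_on_UNIV_nonneg_real_iff) (auto intro: summable_divide summable_geometric)
  then have "(\<lambda>j. q ^ j / q) summable_on {1..}"
    by (rule summable_on_subset_banach) simp
  then show ?thesis
  proof (rule summable_on_comparison_test)
    show "(\<Prod>i\<in>{1..<j}. r i) \<le> q ^ j / q" if "j \<in> {1..}" for j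
      using ratio_prod_le[of r q j] that assms by (simp add: power_diff)
    show "0 \<le> (\<Prod>i\<in>{1..<j}. r i)" for j
      using assms by (intro prod_nonneg) auto
  qed
qed

lemma pmf_expectation_eq_infsum:
  fixes g :: "'a \<Rightarrow> real"
  assumes "integrable (measure_pmf P) g"
  shows "measure_pmf.expectation P g = (\<Sum>\<^sub>\<infinity>x. pmf P x * g x)"
proof -
  have "integrable (count_space UNIV) (\<lambda>x. pmf P x * g x)"
    using assms unfolding measure_pmf_eq_density by (subst (asm) integrable_density) auto
  then have summable: "Infinite_Set_Sum.abs_summable_on (\<lambda>x. pmf P x * g x) UNIV"
    by (simp add: Infinite_Set_Sum.abs_summable_on_def)
  have "measure_pmf.expectation P g = infsetsum (\<lambda>x. pmf P x * g x) UNIV"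
    unfolding measure_pmf_eq_density infsetsum_def by (subst integral_density) auto
  then show ?thesis
    by (simp add: infsetsum_infsum[OF summable])
qed

text \<open>The kernel is prescribed only off state 1, which receives whatever mass remains. Hence
  resetting and, from state 1, staying need not be told apart, and both chains are
  instances.\<close>

locale reset_chain =
  fixes K :: "nat \<Rightarrow> nat pmf" and up stay :: "nat \<Rightarrow> real" and q :: real
  assumes pmf_kernel: "\<And>d e. d \<ge> 1 \<Longrightarrow> e \<noteq> 1 \<Longrightarrow>
      pmf (K d) e = (if e = d + 1 then up d else 0) + (if e = d then stay d else 0)"
    and up_nonneg: "\<And>d. 0 \<le> up d"
    and stay_less_1: "\<And>d. stay d < 1"
    and ratio_le: "\<And>d. d \<ge> 1 \<Longrightarrow> up d / (1 - stay (d + 1)) \<le> q"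
    and q_pos: "0 < q" and q_less_1: "q < 1"
begin

text \<open>The solution of the balance equations on the positive states with value 1 at state 1,
  before normalisation.\<close>

definition weight :: "nat \<Rightarrow> real" where
  "weight j = (\<Prod>i\<in>{1..<j}. up i / (1 - stay (i + 1)))"

lemma weight_1 [simp]: "weight (Suc 0) = 1"
  by (simp add: weight_def)

lemma weight_Suc: "j \<ge> 1 \<Longrightarrow> weight (Suc j) = up j / (1 - stay (Suc j)) * weight j"
  by (simp add: weight_def)

lemma ratio_nonneg: "0 \<le> up d / (1 - stay (d + 1))"
  using up_nonneg[of d] stay_less_1[of "d + 1"] by simp

lemma weight_nonneg: "0 \<le> weight j"
  unfolding weight_def using ratio_nonneg by (intro prod_nonneg) auto

lemma weight_summable: "weight summable_on {1..}"
  unfolding weight_def[abs_def]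
  using ratio_nonneg ratio_le q_pos q_less_1 by (intro summable_on_ratio_prod)

lemma infsum_weight_pos: "infsum weight {1..} > 0"
proof -
  have "infsum weight {1} \<le> infsum weight {1..}"
    using weight_summable weight_nonneg by (intro infsum_mono_neutral) auto
  then show ?thesis by simp
qed

text \<open>A state \<open>Suc e\<close> above 1 is not hit by a reset, so it is reached only by a
  step up from \<open>e\<close> or by staying.\<close>

lemma pmf_bind_kernel:
  assumes "set_pmf \<pi> \<subseteq> {1..}" "e \<ge> 1"
  shows "pmf (bind_pmf \<pi> K) (Suc e) = pmf \<pi> e * up e + pmf \<pi> (Suc e) * stay (Suc e)"
proof -
  have "pmf (bind_pmf \<pi> K) (Suc e) = (\<integral>d. pmf (K d) (Suc e) \<partial>measure_pmf \<pi>)"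
    by (rule pmf_bind)
  also have "\<dots> = (\<Sum>d\<in>{e, Suc e}. pmf (K d) (Suc e) * pmf \<pi> d)"
  proof (rule integral_measure_pmf_real)
    fix d assume "d \<in> set_pmf \<pi>" "pmf (K d) (Suc e) \<noteq> 0"
    then show "d \<in> {e, Suc e}"
      using assms pmf_kernel[of d "Suc e"] by (auto split: if_splits)
  qed simp
  also have "\<dots> = pmf \<pi> e * up e + pmf \<pi> (Suc e) * stay (Suc e)"
    using assms(2) by (simp add: pmf_kernel)
  finally show ?thesis .
qed

text \<open>Balance at \<open>Suc e\<close> is solved for \<open>pmf \<pi> (Suc e)\<close> through
  division by \<open>1 - stay (Suc e) > 0\<close>. Balance at 0 is trivial because positive states
  never lead there, and balance at 1 follows from total mass.\<close>

lemma stationary_distribution_iff: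
  "stationary_distribution {1..} K \<pi> \<longleftrightarrow>
     pmf \<pi> 0 = 0 \<and> (\<forall>e\<ge>1. pmf \<pi> (Suc e) = up e / (1 - stay (Suc e)) * pmf \<pi> e)"
proof -
  have supp: "set_pmf \<pi> \<subseteq> {1..} \<longleftrightarrow> pmf \<pi> 0 = 0"
    by (auto simp: set_pmf_iff subset_iff Suc_le_eq intro: gr0I)
  have balance: "pmf \<pi> (Suc e) = up e / (1 - stay (Suc e)) * pmf \<pi> e \<longleftrightarrow>
      pmf (bind_pmf \<pi> K) (Suc e) = pmf \<pi> (Suc e)"
    if "set_pmf \<pi> \<subseteq> {1..}" "e \<ge> 1" for e
    using stay_less_1[of "Suc e"]
    by (subst pmf_bind_kernel[OF that]) (auto simp: field_simps)
  have zero: "pmf (bind_pmf \<pi> K) 0 = 0" if "set_pmf \<pi> \<subseteq> {1..}"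
  proof -
    have "pmf (K d) 0 = 0" if "d \<in> set_pmf \<pi>" for d
      using that \<open>set_pmf \<pi> \<subseteq> {1..}\<close> pmf_kernel[of d 0] by auto
    then show ?thesis
      by (auto simp: pmf_eq_0_set_pmf)
  qed
  have "bind_pmf \<pi> K = \<pi> \<longleftrightarrow> (\<forall>e\<ge>1. pmf (bind_pmf \<pi> K) (Suc e) = pmf \<pi> (Suc e))"
    if S: "set_pmf \<pi> \<subseteq> {1..}"
  proof
    assume *: "\<forall>e\<ge>1. pmf (bind_pmf \<pi> K) (Suc e) = pmf \<pi> (Suc e)"
    show "bind_pmf \<pi> K = \<pi>"
    proof (rule pmf_eqI_except_one[of 1])
      fix x :: nat assume "x \<noteq> 1"
      then consider "x = 0" | e where "x = Suc e" "e \<ge> 1"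
        by (cases x) auto
      then show "pmf (bind_pmf \<pi> K) x = pmf \<pi> x"
        using * zero[OF S] S supp by cases auto
    qed
  qed simp
  then show ?thesis
    using balance supp unfolding stationary_distribution_def by blast
qed

text \<open>State 0 is cut out explicitly because \<open>weight 0\<close> is an empty product, hence
  1.\<close>

definition stationary :: "nat pmf" where
  "stationary = embed_pmf (\<lambda>j. if j \<ge> 1 then weight j / infsum weight {1..} else 0)"

lemma pmf_stationary:
  "pmf stationary j = (if j \<ge> 1 then weight j / infsum weight {1..} else 0)"
proof -
  let ?W = "infsum weight {1..}"
  let ?g = "\<lambda>j. if j \<ge> 1 then weight j / ?W else 0"
  have "((\<lambda>j. weight j * (1 / ?W)) has_sum (?W * (1 / ?W))) {1..}"
    using weight_summable by (intro has_sum_cmult_left has_sum_infsum)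
  then have "((\<lambda>j. weight j / ?W) has_sum 1) {1..}"
    using infsum_weight_pos by simp
  then have "(?g has_sum 1) UNIV"
    by (rule has_sum_cong_neutral[THEN iffD1, rotated -1]) auto
  then have "?g sums 1"
    by (rule has_sum_imp_sums)
  moreover have nonneg: "0 \<le> ?g j" for j
    using weight_nonneg infsum_weight_pos by simp
  ultimately have "(\<integral>\<^sup>+j. ennreal (?g j) \<partial>count_space UNIV) = 1"
    by (subst nn_integral_count_space_nat) (simp only: suminf_ennreal_eq ennreal_1)
  then show ?thesis
    unfolding stationary_def using nonneg by (intro pmf_embed_pmf)
qed

lemma stationary_distribution_unique:
  "stationary_distribution {1..} K \<pi> \<longleftrightarrow> \<pi> = stationary"
proof
  assume \<pi>: "stationary_distribution {1..} K \<pi>"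
  then have zero: "pmf \<pi> 0 = 0"
    and step: "\<And>e. e \<ge> 1 \<Longrightarrow> pmf \<pi> (Suc e) = up e / (1 - stay (Suc e)) * pmf \<pi> e"
    unfolding stationary_distribution_iff by blast+
  have weight: "pmf \<pi> j = pmf \<pi> 1 * weight j" if "j \<ge> 1" for j
    using that
    by (induction j rule: dec_induct) (simp_all only: step weight_Suc One_nat_def weight_1 mult_ac mult_1_right)
  \<comment> \<open>The recursion fixes \<pi> up to the factor \<open>pmf \<pi> 1\<close>; equal
    total masses then identify the two distributions.\<close>
  have "pmf \<pi> j = (pmf \<pi> 1 * infsum weight {1..}) * pmf stationary j" for j
  proof (cases "j = 0")
    case False
    then show ?thesis
      using infsum_weight_pos by (subst weight) (simp_all add: pmf_stationary)
  qed (simp add: zero pmf_stationary)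
  then show "\<pi> = stationary"
    by (rule pmf_eqI_proportional)
next
  assume "\<pi> = stationary"
  then show "stationary_distribution {1..} K \<pi>"
    unfolding stationary_distribution_iff by (simp add: pmf_stationary weight_Suc)
qed

lemma ex1_stationary_distribution: "\<exists>!\<pi>. stationary_distribution {1..} K \<pi>"
  and the_stationary_distribution: "(THE \<pi>. stationary_distribution {1..} K \<pi>) = stationary"
  by (simp_all only: stationary_distribution_unique ex1_eq the_eq_trivial simp_thms)

lemma expectation_stationary:
  assumes "integrable (measure_pmf stationary) g"
  shows "measure_pmf.expectation stationary g =
    (\<Sum>\<^sub>\<infinity>j\<in>{1..}. weight j * g j) / infsum weight {1..}"
proof -
  have "measure_pmf.expectation stationary g =
      (\<Sum>\<^sub>\<infinity>j\<in>{1..}. weight j * g j * (1 / infsum weight {1..}))"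
    unfolding pmf_expectation_eq_infsum[OF assms]
    by (intro infsum_cong_neutral) (auto simp: pmf_stationary)
  then show ?thesis
    by (simp only: infsum_cmult_left') simp
qed

lemma pmf_stationary_1: "pmf stationary 1 = 1 / infsum weight {1..}"
  by (simp add: pmf_stationary)

lemma AE_stationary_ge_1: "AE d in measure_pmf stationary. d \<ge> 1"
  by (auto simp: AE_measure_pmf_iff set_pmf_eq pmf_stationary)

text \<open>One step from stationarity leaves the law unchanged, so the mean probability of landing
  in 1 is the mass of 1, where \<open>weight\<close> is 1.\<close>

lemma expectation_return:
  "measure_pmf.expectation stationary (\<lambda>d. pmf (K d) 1) = 1 / infsum weight {1..}"
proof -
  have "bind_pmf stationary K = stationary"
    using stationary_distribution_unique unfolding stationary_distribution_def by blast
  then show ?thesis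
    by (simp only: pmf_bind[symmetric] pmf_stationary_1)
qed

end

lemma theta_ratio_le:
  fixes p :: real
  assumes "0 < p" "p < 1" "i \<ge> 1"
  shows "p * (1 - p) ^ i / (1 - (1 - p) ^ (i + 2)) \<le> 1 - p"
proof -
  have "(1 - p) ^ (i + 2) \<le> (1 - p) ^ 1" "(1 - p) ^ i \<le> (1 - p) ^ 1"
    using assms by (intro power_decreasing; simp)+
  \<comment> \<open>The numerator is at most \<open>p * (1 - p)\<close> since
    \<open>i \<ge> 1\<close>, and the denominator at least \<open>1 - (1 - p) = p\<close>.\<close>
  then have "p * (1 - p) ^ i / (1 - (1 - p) ^ (i + 2)) \<le> p * (1 - p) / p"
    using assms by (intro frac_le mult_left_mono) (simp_all del: power_Suc)
  then show ?thesis
    using assms by simp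
qed

lemma prod_power_triangular:
  "(\<Prod>i\<in>{1..<j}. q ^ i) = q ^ (j * (j - 1) div 2)" for q :: "'a :: comm_semiring_1"
proof -
  have "\<Sum>{1..<j} = j * (j - 1) div 2"
  proof (induction j)
    case (Suc j)
    \<comment> \<open>The case split on \<open>j\<close> resolves the truncated subtraction
      \<open>j - 1\<close>.\<close>
    then show ?case
      by (cases j) (auto simp: algebra_simps)
  qed simp
  then show ?thesis
    by (simp add: power_sum[symmetric])
qed

text \<open>Existence and uniqueness give the definite descriptions in the rates their meaning;
  summability ensures that no infinite sum is the default value 0 of a divergent series.\<close>

theorem theorem6p3p1:
  fixes p :: real
  assumes "p \<in> {0<..<1}"
  shows "(\<exists>!\<pi>. stationary_distribution {1..} (theta_step p) \<pi>)
    \<and> (\<exists>!\<pi>. stationary_distribution {1..} (phi_step p) \<pi>)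
    \<and> ((\<lambda>j. (\<Prod>i\<in>{1..<j}. p * (1 - p) ^ i / (1 - (1 - p) ^ (i + 2))) * (1 - p) ^ j)
           summable_on {1::nat..})
    \<and> ((\<lambda>j. \<Prod>i\<in>{1..<j}. p * (1 - p) ^ i / (1 - (1 - p) ^ (i + 2))) summable_on {1::nat..})
    \<and> ((\<lambda>j. (1 - p) ^ (j * (j - 1) div 2)) summable_on {1::nat..})
    \<and> (f_rate p = 1 -
           (\<Sum>\<^sub>\<infinity>j\<in>{1::nat..}.
              (\<Prod>i\<in>{1..<j}. p * (1 - p) ^ i / (1 - (1 - p) ^ (i + 2))) * (1 - p) ^ j) /
           (\<Sum>\<^sub>\<infinity>j\<in>{1::nat..}.
              \<Prod>i\<in>{1..<j}. p * (1 - p) ^ i / (1 - (1 - p) ^ (i + 2))))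
    \<and> (h_rate p = 1 / (\<Sum>\<^sub>\<infinity>j\<in>{1::nat..}. (1 - p) ^ (j * (j - 1) div 2)))"
proof -
  have p: "0 < p" "p < 1"
    using assms by auto
  \<comment> \<open>Staying at \<open>d + 1\<close> has probability
    \<open>(1 - p) ^ (d + 2)\<close>, whence the exponent \<open>i + 2\<close> in the
    ratios.\<close>
  interpret \<theta>: reset_chain "theta_step p" "\<lambda>d. p * (1 - p) ^ d" "\<lambda>d. (1 - p) ^ (d + 1)" "1 - p"
    using p theta_ratio_le[OF p] power_Suc_less_one[of "1 - p"]
    by unfold_locales (auto simp: pmf_theta_step[OF assms])
  interpret \<phi>: reset_chain "phi_step p" "\<lambda>d. (1 - p) ^ d" "\<lambda>_. 0" "1 - p"
    using p power_decreasing[of 1 _ "1 - p"]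
    by unfold_locales (auto simp: pmf_phi_step[OF assms])
  have \<theta>_weight: "\<theta>.weight = (\<lambda>j. \<Prod>i\<in>{1..<j}. p * (1 - p) ^ i / (1 - (1 - p) ^ (i + 2)))"
    unfolding fun_eq_iff \<theta>.weight_def by simp
  have \<phi>_weight: "\<phi>.weight = (\<lambda>j. (1 - p) ^ (j * (j - 1) div 2))"
    unfolding fun_eq_iff \<phi>.weight_def by (simp only: prod_power_triangular diff_zero div_by_1 simp_thms)
  have power_le_1: "(1 - p) ^ j \<le> 1" for j
    using p by (simp add: power_le_one)
  have "(\<lambda>j. \<theta>.weight j * (1 - p) ^ j) summable_on {1..}"
    using p power_le_1 \<theta>.weight_nonneg
    by (intro summable_on_comparison_test[OF \<theta>.weight_summable])
      (auto intro!: mult_left_le)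
  \<comment> \<open>The rate is averaged directly: \<open>pmf (theta_step p 1) 1\<close> also counts
    staying at 1, so \<open>\<theta>.expectation_return\<close> would not give
    \<open>f_rate p\<close>.\<close>
  moreover have "f_rate p =
    1 - (\<Sum>\<^sub>\<infinity>j\<in>{1..}. \<theta>.weight j * (1 - p) ^ j) / infsum \<theta>.weight {1..}"
  proof -
    have "integrable (measure_pmf \<theta>.stationary) (\<lambda>d. (1 - p) ^ d)"
      using p power_le_1 by (intro measure_pmf.integrable_const_bound[where B = 1]) auto
    then show ?thesis
      unfolding f_rate_def \<theta>.the_stationary_distribution
      by (subst \<theta>.expectation_stationary[symmetric]) simp_all
  qed
  moreover have "h_rate p = 1 / infsum \<phi>.weight {1..}"
  proof -
    \<comment> \<open>At \<open>d = 0\<close> the step up also lands in 1, so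
      \<open>pmf (phi_step p d) 1\<close> is \<open>1 - (1 - p) ^ d\<close> only for
      \<open>d \<ge> 1\<close>; this holds almost everywhere.\<close>
    have "h_rate p = measure_pmf.expectation \<phi>.stationary (\<lambda>d. pmf (phi_step p d) 1)"
      unfolding h_rate_def \<phi>.the_stationary_distribution
      using \<phi>.AE_stationary_ge_1
      by (intro integral_cong_AE) (auto simp: pmf_phi_step[OF assms] elim!: eventually_mono)
    then show ?thesis
      by (simp only: \<phi>.expectation_return)
  qed
  ultimately show ?thesis
    using \<theta>.ex1_stationary_distribution \<phi>.ex1_stationary_distribution
      \<theta>.weight_summable \<phi>.weight_summable
    unfolding \<theta>_weight \<phi>_weight by blast
qed

end
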